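(* $\mathsf{ATR} \leq_W \mathsf{KDT}$.
   Context: Problems are (possibly partial) multivalued functions between represented spaces. $P\leq_W Q$: there are computable partial $\Phi,\Psi:\subseteq\mathbb{N}^\mathbb{N}\to\mathbb{N}^\mathbb{N}$ such that for each name $p$ of a $P$-instance, $\Phi(p)$ names a $Q$-instance, and for each name $q$ of a $Q$-solution to it, $\Psi(p\oplus q)$ names a $P$-solution of $p$. Well-orderings on subsets of $\mathbb{N}$ are represented by $\{\langle a,b\rangle: a\leq_L b\}$. Jump hierarchy on $L$ (first element $0_L$) starting with $A$: $X_{0_L}=A$, $X_b=(\bigoplus_{a<_Lb}X_a)'$ for $b>_L 0_L$. $\mathsf{ATR}$: given a countable well-ordering $L$ and $A\subseteq\mathbb{N}$, output the unique jump hierarchy on $L$ starting with $A$. $\mathsf{KDT}$: given a countable bipartite graph $G$ (represented by its vertex set and edge relation), produce a König cover $(C,M)$: $M$ a matching (set of pairwise vertex-disjoint edges) and $C$ a vertex cover obtained by choosing exactly one vertex from each edge of $M$. *)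

theory Defs
  imports Main "HOL-Library.Nat_Bijection" "HOL-Library.Disjoint_Sets"
begin

type_synonym baire = "nat \<Rightarrow> nat"


section \<open>Computability on Baire space\<close>

text \<open>Programs for the partial recursive functions of one argument relative to an oracle;
  several arguments are combined into one by the Cantor pairing \<^const>\<open>prod_encode\<close>.\<close>

datatype prog =
    Zero
  | Succ
  | Proj1
  | Proj2
  | Query
  | Tuple prog prog
  | Comp prog prog
  | PrimRec prog prog
  | Mu prog

primrec run :: "baire \<Rightarrow> prog \<Rightarrow> nat \<Rightarrow> nat option" where
  "run p Zero x = Some 0"
| "run p Succ x = Some (Suc x)"
| "run p Proj1 x = Some (fst (prod_decode x))"
| "run p Proj2 x = Some (snd (prod_decode x))"
| "run p Query x = Some (p x)"
| "run p (Tuple c d) x =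
     Option.bind (run p c x) (\<lambda>y. Option.bind (run p d x) (\<lambda>z. Some (prod_encode (y, z))))"
| "run p (Comp c d) x = Option.bind (run p d x) (run p c)"
| "run p (PrimRec c d) x =
     (let (a, n) = prod_decode x in
       rec_nat (run p c a)
         (\<lambda>m r. Option.bind r (\<lambda>y. run p d (prod_encode (a, prod_encode (m, y))))) n)"
| "run p (Mu c) x =
     (if \<exists>k. run p c (prod_encode (x, k)) = Some 0 \<and>
             (\<forall>j<k. run p c (prod_encode (x, j)) \<noteq> None)
      then Some (LEAST k. run p c (prod_encode (x, k)) = Some 0)
      else None)"

definition prog_functional :: "prog \<Rightarrow> baire \<rightharpoonup> baire" where
  "prog_functional c p =
     (if \<forall>n. run p c n \<noteq> None then Some (\<lambda>n. the (run p c n)) else None)"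

text \<open>As usual in computable analysis, a program for \<open>F\<close> has to be correct on the domain
  of \<open>F\<close>, but need not diverge outside of it.\<close>

definition computable :: "(baire \<rightharpoonup> baire) \<Rightarrow> bool" where
  "computable F \<longleftrightarrow> (\<exists>c. F \<subseteq>\<^sub>m prog_functional c)"

primrec prog_number :: "prog \<Rightarrow> nat" where
  "prog_number Zero = 0"
| "prog_number Succ = 1"
| "prog_number Proj1 = 2"
| "prog_number Proj2 = 3"
| "prog_number Query = 4"
| "prog_number (Tuple c d) = 4 * prod_encode (prog_number c, prog_number d) + 5"
| "prog_number (Comp c d) = 4 * prod_encode (prog_number c, prog_number d) + 6"
| "prog_number (PrimRec c d) = 4 * prod_encode (prog_number c, prog_number d) + 7"
| "prog_number (Mu c) = 4 * prog_number c + 8"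

lemma inj_prog_number: "inj prog_number"
proof (rule injI)
  fix c d show "prog_number c = prog_number d \<Longrightarrow> c = d"
  proof (induction c arbitrary: d)
    case Zero then show ?case by (cases d) auto
  next
    case Succ then show ?case by (cases d) auto
  next
    case Proj1 then show ?case by (cases d) auto
  next
    case Proj2 then show ?case by (cases d) auto
  next
    case Query then show ?case by (cases d) auto
  next
    case (Tuple c1 c2)
    then show ?case by (cases d) (auto, presburger+)
  next
    case (Comp c1 c2)
    then show ?case by (cases d) (auto, presburger+)
  next
    case (PrimRec c1 c2)
    then show ?case by (cases d) (auto, presburger+)
  next
    case (Mu c)
    then show ?case by (cases d) (auto, presburger+)
  qed
qed

lemma surj_prog_number: "surj prog_number"
proof -
  have "\<exists>c. prog_number c = n" for n
  proof (induction n rule: less_induct)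
    case (less n)
    show ?case
    proof (cases "n < 5")
      case True
      then have "n = 0 \<or> n = 1 \<or> n = 2 \<or> n = 3 \<or> n = 4" by linarith
      then show ?thesis
        using prog_number.simps(1-5) by metis
    next
      case False
      define m where "m = (n - 5) div 4"
      obtain a b where ab: "m = prod_encode (a, b)"
        by (metis prod_decode_inverse surj_pair)
      have "m < n" using False by (simp add: m_def)
      moreover have "a \<le> m" "b \<le> m"
        by (simp_all add: ab le_prod_encode_1 le_prod_encode_2)
      ultimately obtain c d e where
        "prog_number c = a" "prog_number d = b" "prog_number e = m"
        by (meson less le_less_trans)
      moreover have "n = 4 * m + 5 \<or> n = 4 * m + 6 \<or> n = 4 * m + 7 \<or> n = 4 * m + 8"
        using False unfolding m_def by presburger
      ultimately show ?thesis
        using prog_number.simps(6-9) ab by metis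
    qed
  qed
  then show ?thesis by (metis surjI)
qed

text \<open>\<^const>\<open>prog_number\<close> is a bijection onto the natural numbers, so the jump of \<open>X\<close> is the
  diagonal halting set of all \<open>e\<close> such that the program number \<open>e\<close> halts on input \<open>e\<close>
  with oracle \<open>X\<close>.\<close>

definition char_fun :: "nat set \<Rightarrow> baire" where
  "char_fun X n = (if n \<in> X then 1 else 0)"

definition jump :: "nat set \<Rightarrow> nat set" where
  "jump X = {prog_number c | c. run (char_fun X) c (prog_number c) \<noteq> None}"


section \<open>Represented spaces, problems and Weihrauch reducibility\<close>

text \<open>A representation is a partial map from names to the objects they name.\<close>

type_synonym 'a representation = "baire \<rightharpoonup> 'a"

text \<open>The instances are listed separately, since the represented space may contain points
  that are not in the domain of the problem.\<close>

record ('a, 'b) problem =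
  instance_rep :: "'a representation"
  solution_rep :: "'b representation"
  instances :: "'a set"
  solutions :: "'a \<Rightarrow> 'b set"

definition join :: "baire \<Rightarrow> baire \<Rightarrow> baire" (infixr \<open>\<oplus>\<^sub>B\<close> 65) where
  "(p \<oplus>\<^sub>B q) n = (if even n then p (n div 2) else q (n div 2))"

definition weihrauch_le ::
  "('a, 'b) problem \<Rightarrow> ('c, 'd) problem \<Rightarrow> bool" (infix \<open>\<le>\<^sub>W\<close> 50) where
  "P \<le>\<^sub>W Q \<longleftrightarrow>
     (\<exists>\<Phi> \<Psi>. computable \<Phi> \<and> computable \<Psi> \<and>
       (\<forall>p x. instance_rep P p = Some x \<and> x \<in> instances P \<longrightarrow>
         (\<exists>p' x'. \<Phi> p = Some p' \<and> instance_rep Q p' = Some x' \<and> x' \<in> instances Q \<and>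
           (\<forall>q y'. solution_rep Q q = Some y' \<and> y' \<in> solutions Q x' \<longrightarrow>
             (\<exists>q' y. \<Psi> (p \<oplus>\<^sub>B q) = Some q' \<and> solution_rep P q' = Some y \<and>
                y \<in> solutions P x)))))"

definition prod_rep ::
  "'a representation \<Rightarrow> 'b representation \<Rightarrow> ('a \<times> 'b) representation" where
  "prod_rep \<delta> \<epsilon> p =
     Option.bind (\<delta> (\<lambda>n. p (2 * n)))
       (\<lambda>x. Option.bind (\<epsilon> (\<lambda>n. p (2 * n + 1))) (\<lambda>y. Some (x, y)))"

definition set_rep :: "nat set representation" where
  "set_rep p = (if range p \<subseteq> {0, 1} then Some {n. p n = 1} else None)"

definition rel_rep :: "nat rel representation" where
  "rel_rep p = map_option (\<lambda>S. {(a, b). prod_encode (a, b) \<in> S}) (set_rep p)"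

definition seq_rep :: "(nat \<Rightarrow> nat set) representation" where
  "seq_rep p = map_option (\<lambda>S a. {n. prod_encode (a, n) \<in> S}) (set_rep p)"


section \<open>Arithmetical transfinite recursion\<close>

text \<open>A pair \<open>(a, b) \<in> L\<close> means that \<open>a\<close> is less than or equal to \<open>b\<close>; the elements of the
  ordering are those of \<open>Field L\<close>, and \<open>b\<close> is the first one iff \<open>underS L b = {}\<close>.
  A hierarchy is a family indexed by \<open>Field L\<close>, extended by the empty set to all of
  the natural numbers.\<close>

definition join_family :: "nat set \<Rightarrow> (nat \<Rightarrow> nat set) \<Rightarrow> nat set" where
  "join_family S X = {prod_encode (a, n) | a n. a \<in> S \<and> n \<in> X a}"

definition jump_hierarchy :: "nat rel \<Rightarrow> nat set \<Rightarrow> (nat \<Rightarrow> nat set) \<Rightarrow> bool" where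
  "jump_hierarchy L A X \<longleftrightarrow>
     (\<forall>b\<in>Field L. X b = (if underS L b = {} then A else jump (join_family (underS L b) X))) \<and>
     (\<forall>b. b \<notin> Field L \<longrightarrow> X b = {})"

definition ATR :: "(nat rel \<times> nat set, nat \<Rightarrow> nat set) problem" where
  "ATR = \<lparr>instance_rep = prod_rep rel_rep set_rep,
          solution_rep = seq_rep,
          instances = {(L, A). Well_order L},
          solutions = (\<lambda>(L, A). {X. jump_hierarchy L A X})\<rparr>"


section \<open>Koenig covers of bipartite graphs\<close>

type_synonym graph = "nat set \<times> nat set set"

definition edges_rep :: "nat set set representation" where
  "edges_rep p =
     Option.bind (rel_rep p)
       (\<lambda>R. if sym R \<and> irrefl R then Some {{u, v} | u v. (u, v) \<in> R} else None)"

definition bipartite :: "graph \<Rightarrow> bool" where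
  "bipartite = (\<lambda>(V, E). \<exists>A B. A \<union> B = V \<and> A \<inter> B = {} \<and>
     (\<forall>e\<in>E. \<exists>a\<in>A. \<exists>b\<in>B. e = {a, b}))"

definition matching :: "graph \<Rightarrow> nat set set \<Rightarrow> bool" where
  "matching = (\<lambda>(V, E) M. M \<subseteq> E \<and> disjoint M)"

definition vertex_cover :: "graph \<Rightarrow> nat set \<Rightarrow> bool" where
  "vertex_cover = (\<lambda>(V, E) C. C \<subseteq> V \<and> (\<forall>e\<in>E. e \<inter> C \<noteq> {}))"

definition konig_cover :: "graph \<Rightarrow> nat set \<times> nat set set \<Rightarrow> bool" where
  "konig_cover G = (\<lambda>(C, M). matching G M \<and> vertex_cover G C \<and>
     C \<subseteq> \<Union>M \<and> (\<forall>e\<in>M. \<exists>!v. v \<in> e \<inter> C))"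

definition KDT :: "(graph, nat set \<times> nat set set) problem" where
  "KDT = \<lparr>instance_rep = prod_rep set_rep edges_rep,
          solution_rep = prod_rep set_rep edges_rep,
          instances = {G. bipartite G},
          solutions = (\<lambda>G. {K. konig_cover G K})\<rparr>"

end

theory Submission
  imports Defs
begin

text \<open>The play trees of a game, with every continuation duplicated, form a forest. In every
  Koenig cover of it the vertices at which the player to move wins are covered and the roots at
  which he loses are not, provided that the game is determined there by well-founded play. So it
  suffices to find a game with a uniformly decidable move relation in which membership in the sets
  of the jump hierarchy is the question who wins. No universal machine is needed for this: the
  players debate a computation by recursion on the program, and a query to the oracle leads to a
  membership position with a smaller index in the well-ordering.\<close>

section \<open>Closure properties of computable functions\<close>

text \<open>Totality for all oracles, not only for names, spares any bookkeeping of domains.\<close>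

definition effective :: "(baire \<Rightarrow> nat \<Rightarrow> nat) \<Rightarrow> bool" where
  "effective f \<longleftrightarrow> (\<exists>c. \<forall>p x. run p c x = Some (f p x))"

definition effective_pred :: "(baire \<Rightarrow> nat \<Rightarrow> bool) \<Rightarrow> bool" where
  "effective_pred P \<longleftrightarrow> effective (\<lambda>p x. of_bool (P p x))"

lemma effective_Suc: "effective f \<Longrightarrow> effective (\<lambda>p x. Suc (f p x))"
  unfolding effective_def by (metis bind.bind_lunit run.simps(2,7))

lemma effective_fst: "effective f \<Longrightarrow> effective (\<lambda>p x. fst (prod_decode (f p x)))"
  unfolding effective_def by (metis bind.bind_lunit run.simps(3,7))

lemma effective_snd: "effective f \<Longrightarrow> effective (\<lambda>p x. snd (prod_decode (f p x)))"
  unfolding effective_def by (metis bind.bind_lunit run.simps(4,7))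

lemma effective_query: "effective f \<Longrightarrow> effective (\<lambda>p x. p (f p x))"
  unfolding effective_def by (metis bind.bind_lunit run.simps(5,7))

lemma effective_pair:
  assumes "effective f" "effective g"
  shows "effective (\<lambda>p x. prod_encode (f p x, g p x))"
proof -
  obtain c d where "\<forall>p x. run p c x = Some (f p x)" "\<forall>p x. run p d x = Some (g p x)"
    using assms unfolding effective_def by blast
  then have "\<forall>p x. run p (Tuple c d) x = Some (prod_encode (f p x, g p x))" by simp
  then show ?thesis unfolding effective_def by blast
qed

lemma effective_id: "effective (\<lambda>p x. x)"
proof -
  have "\<forall>p x. run p (Tuple Proj1 Proj2) x = Some x" by simp
  then show ?thesis unfolding effective_def by blast
qed

lemma effective_const: "effective (\<lambda>p x. k)"
proof (induction k)
  case 0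
  have "\<forall>p x. run p Zero x = Some 0" by simp
  then show ?case unfolding effective_def by blast
qed (rule effective_Suc)

text \<open>\<open>PrimRec\<close> hands its step program a code of parameter, counter and previous
  value; taking the whole input \<open>x\<close> as parameter lets the step depend on
  \<open>x\<close>.\<close>

lemma effective_rec_nat:
  assumes "effective f" "effective n"
    and "effective (\<lambda>p z. g p (fst (prod_decode z))
      (fst (prod_decode (snd (prod_decode z)))) (snd (prod_decode (snd (prod_decode z)))))"
  shows "effective (\<lambda>p x. rec_nat (f p x) (g p x) (n p x))"
proof -
  obtain c d e where c: "\<And>p x. run p c x = Some (f p x)"
    and d: "\<And>p z. run p d z = Some (g p (fst (prod_decode z))
      (fst (prod_decode (snd (prod_decode z)))) (snd (prod_decode (snd (prod_decode z)))))"
    and e: "\<And>p x. run p e x = Some (n p x)"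
    using assms unfolding effective_def by blast
  have rec: "rec_nat (Some (f p x))
      (\<lambda>m r. Option.bind r (\<lambda>y. run p d (prod_encode (x, prod_encode (m, y))))) k =
    Some (rec_nat (f p x) (g p x) k)" for p x k
    by (induction k) (simp_all add: d)
  have "run p (Comp (PrimRec c d) (Tuple (Tuple Proj1 Proj2) e)) x =
      Some (rec_nat (f p x) (g p x) (n p x))" for p x
    by (simp add: c e rec)
  then show ?thesis unfolding effective_def by blast
qed

lemma effective_add:
  assumes "effective f" "effective g"
  shows "effective (\<lambda>p x. f p x + g p x)"
proof -
  have "m + n = rec_nat m (\<lambda>_ r. Suc r) n" for m n
    by (induction n) simp_all
  then show ?thesis
    by (simp only:)
      (intro effective_rec_nat assms effective_Suc effective_snd effective_id)
qed

lemma effective_pred_nat: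
  assumes "effective f"
  shows "effective (\<lambda>p x. f p x - 1)"
proof -
  have "n - 1 = rec_nat 0 (\<lambda>m _. m) n" for n
    by (cases n) simp_all
  then show ?thesis
    by (simp only:)
      (intro effective_rec_nat assms effective_const effective_fst effective_snd effective_id)
qed

lemma effective_diff:
  assumes "effective f" "effective g"
  shows "effective (\<lambda>p x. f p x - g p x)"
proof -
  have "rec_nat m (\<lambda>_ r. r - 1) n = m - n" for m n
    by (induction n) simp_all
  moreover have "effective (\<lambda>p x. rec_nat (f p x) (\<lambda>_ r. r - 1) (g p x))"
    by (intro effective_rec_nat assms effective_pred_nat effective_snd effective_id)
  ultimately show ?thesis by (simp only:)
qed

lemma effective_mult:
  assumes "effective f" "effective g"
  shows "effective (\<lambda>p x. f p x * g p x)"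
proof -
  have "m * n = rec_nat 0 (\<lambda>_ r. r + m) n" for m n
    by (induction n) simp_all
  moreover obtain f' where f': "f' = (\<lambda>p z. f p (fst (prod_decode z)))" "effective f'"
  proof -
    obtain c where "\<forall>p x. run p c x = Some (f p x)"
      using assms(1) unfolding effective_def by blast
    then have "\<forall>p x. run p (Comp c Proj1) x = Some (f p (fst (prod_decode x)))" by simp
    then show thesis using that unfolding effective_def by blast
  qed
  ultimately show ?thesis
    using effective_rec_nat[of "\<lambda>_ _. 0" g "\<lambda>p x _ r. r + f p x"]
      effective_add[OF effective_snd[OF effective_snd[OF effective_id]] f'(2)]
    by (simp add: assms effective_const)
qed

lemma effective_pred_eq:
  assumes "effective f" "effective g"
  shows "effective_pred (\<lambda>p x. f p x = g p x)"
proof -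
  have "of_bool (m = n) = 1 - ((m - n) + (n - m))" for m n :: nat by simp
  then show ?thesis unfolding effective_pred_def
    by (simp only:) (intro effective_diff effective_add effective_const assms)
qed

lemma effective_pred_not:
  assumes "effective_pred P"
  shows "effective_pred (\<lambda>p x. \<not> P p x)"
proof -
  have "of_bool (\<not> b) = 1 - (of_bool b :: nat)" for b by simp
  then show ?thesis using assms unfolding effective_pred_def
    by (simp only:) (intro effective_diff effective_const)
qed

lemma effective_pred_conj:
  assumes "effective_pred P" "effective_pred Q"
  shows "effective_pred (\<lambda>p x. P p x \<and> Q p x)"
proof -
  have "of_bool (a \<and> b) = of_bool a * (of_bool b :: nat)" for a b by simp
  then show ?thesis using assms unfolding effective_pred_def
    by (simp only:) (intro effective_mult)
qed

lemma effective_pred_disj: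
  assumes "effective_pred P" "effective_pred Q"
  shows "effective_pred (\<lambda>p x. P p x \<or> Q p x)"
proof -
  have "a \<or> b \<longleftrightarrow> \<not> (\<not> a \<and> \<not> b)" for a b by simp
  then show ?thesis using assms
    by (simp only:) (intro effective_pred_not effective_pred_conj)
qed

lemma effective_pred_odd:
  assumes "effective f"
  shows "effective_pred (\<lambda>p x. odd (f p x))"
proof -
  have "of_bool (odd n) = rec_nat (0 :: nat) (\<lambda>_ r. 1 - r) n" for n :: nat
    by (induction n) (auto simp: of_bool_def split: if_splits)
  then show ?thesis unfolding effective_pred_def
    by (simp only:)
      (intro effective_rec_nat assms effective_const effective_diff effective_snd effective_id)
qed

lemma effective_div2:
  assumes "effective f"
  shows "effective (\<lambda>p x. f p x div 2)"
proof -
  have "n div 2 = rec_nat 0 (\<lambda>m r. r + of_bool (odd m)) n" for n :: nat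
  proof (induction n)
    case (Suc n)
    then show ?case by (cases "even n") auto
  qed simp
  then show ?thesis
    by (simp only:)
      (intro effective_rec_nat assms effective_const effective_add effective_fst effective_snd
        effective_id effective_pred_odd[unfolded effective_pred_def])
qed

lemmas effective_intros =
  effective_id effective_const effective_Suc effective_fst effective_snd effective_pair
  effective_query effective_add effective_mult effective_pred_nat
  effective_pred_eq effective_pred_not effective_pred_conj effective_pred_disj

lemma computable_effective_pred:
  assumes "effective_pred P"
  shows "computable (\<lambda>p. Some (\<lambda>n. of_bool (P p n)))"
proof -
  obtain c where "\<And>p n. run p c n = Some (of_bool (P p n))"
    using assms unfolding effective_pred_def effective_def by blast
  then show ?thesis
    unfolding computable_def prog_functional_def map_le_def by (intro exI[of _ c]) simp
qed


section \<open>Games and Koenig covers of their play trees\<close>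

text \<open>A player who cannot move loses. Being a least fixed point, the pair omits positions
  where neither player can force a win by well-founded play, so the two predicates need not be
  complementary.\<close>

inductive winning :: "('a \<Rightarrow> 'a \<Rightarrow> bool) \<Rightarrow> 'a \<Rightarrow> bool"
  and losing :: "('a \<Rightarrow> 'a \<Rightarrow> bool) \<Rightarrow> 'a \<Rightarrow> bool"
  for move where
  winningI: "move s t \<Longrightarrow> losing move t \<Longrightarrow> winning move s"
| losingI: "(\<And>t. move s t \<Longrightarrow> winning move t) \<Longrightarrow> losing move s"

text \<open>A false \<phi> has to come with a derivation of losing, not merely of failing to win,
  which excludes undetermined positions.\<close>

definition decided :: "('a \<Rightarrow> 'a \<Rightarrow> bool) \<Rightarrow> bool \<Rightarrow> 'a \<Rightarrow> bool" where
  "decided move \<phi> s \<longleftrightarrow> (if \<phi> then winning move s else losing move s)"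

lemma decidedI:
  assumes "\<And>t. move s t \<Longrightarrow> decided move (\<phi> t) t"
    and "\<psi> \<longleftrightarrow> (\<exists>t. move s t \<and> \<not> \<phi> t)"
  shows "decided move \<psi> s"
  using assms unfolding decided_def by (metis winning_losing.intros)

text \<open>A vertex codes a play, most recent position first. Every position carries an arbitrary
  label, so that each possible continuation of a play occurs more than once.\<close>

definition continue :: "nat \<Rightarrow> nat \<Rightarrow> nat \<Rightarrow> nat" where
  "continue u s i = Suc (prod_encode (prod_encode (s, i), u))"

text \<open>The empty play 0 is never a parent, so each \<open>continue 0 s i\<close> is a root.
  Only the last move is checked; as a play determines its tail, the graph is a forest all the
  same.\<close>

definition play_child :: "(nat \<Rightarrow> nat \<Rightarrow> bool) \<Rightarrow> nat \<Rightarrow> nat \<Rightarrow> bool" where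
  "play_child move u v \<longleftrightarrow>
     (\<exists>w t j s i. u = continue w t j \<and> v = continue u s i \<and> move t s)"

definition play_rel :: "(nat \<Rightarrow> nat \<Rightarrow> bool) \<Rightarrow> nat rel" where
  "play_rel move = {(u, v). play_child move u v \<or> play_child move v u}"

text \<open>Taking every number as a vertex keeps the vertex set computable; isolated vertices are
  never in a Koenig cover.\<close>

definition play_graph :: "(nat \<Rightarrow> nat \<Rightarrow> bool) \<Rightarrow> graph" where
  "play_graph move = (UNIV, {{u, v} | u v. (u, v) \<in> play_rel move})"

lemma continue_inject [simp]:
  "continue u s i = continue v t j \<longleftrightarrow> u = v \<and> s = t \<and> i = j"
  by (auto simp: continue_def)

lemma continue_nonzero [simp]: "continue u s i \<noteq> 0"
  by (simp add: continue_def)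

lemma length_list_decode_continue:
  "length (list_decode (continue u s i)) = Suc (length (list_decode u))"
  by (simp add: continue_def)

lemma play_child_parity:
  "play_child move u v \<Longrightarrow> even (length (list_decode u)) \<longleftrightarrow> odd (length (list_decode v))"
  unfolding play_child_def using length_list_decode_continue by force

lemma sym_play_rel: "sym (play_rel move)"
  by (auto simp: play_rel_def sym_def)

lemma irrefl_play_rel: "irrefl (play_rel move)"
  using play_child_parity by (auto simp: play_rel_def irrefl_def)

lemma bipartite_play_graph: "bipartite (play_graph move)"
proof -
  define A where "A = {v. even (length (list_decode v))}"
  have "\<exists>a\<in>A. \<exists>b\<in>- A. e = {a, b}" if "e = {u, v}" "(u, v) \<in> play_rel move" for e u v
  proof -
    have "u \<in> A \<longleftrightarrow> v \<notin> A"
      using that(2) play_child_parity[of move u v] play_child_parity[of move v u]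
      unfolding play_rel_def A_def by auto
    moreover have "{u, v} = {v, u}" by blast
    ultimately show ?thesis using that(1) by (cases "u \<in> A") auto
  qed
  then have "\<forall>e\<in>{{u, v} | u v. (u, v) \<in> play_rel move}. \<exists>a\<in>A. \<exists>b\<in>- A. e = {a, b}"
    by auto
  then have "A \<union> - A = UNIV \<and> A \<inter> - A = {} \<and>
      (\<forall>e\<in>{{u, v} | u v. (u, v) \<in> play_rel move}. \<exists>a\<in>A. \<exists>b\<in>- A. e = {a, b})"
    by simp
  then show ?thesis
    unfolding bipartite_def play_graph_def prod.case by (intro exI)
qed

context
  fixes move :: "nat \<Rightarrow> nat \<Rightarrow> bool" and C :: "nat set" and M :: "nat set set"
  assumes cover: "konig_cover (play_graph move) (C, M)"
begin

lemma cover_edge: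
  assumes "play_child move u v"
  shows "u \<in> C \<or> v \<in> C"
proof -
  have "{u, v} \<in> snd (play_graph move)"
    using assms unfolding play_graph_def play_rel_def by auto
  moreover have "\<forall>e\<in>snd (play_graph move). e \<inter> C \<noteq> {}"
    using cover unfolding konig_cover_def vertex_cover_def play_graph_def by simp
  ultimately have "{u, v} \<inter> C \<noteq> {}" by blast
  then show ?thesis by auto
qed

text \<open>\<open>C\<close> consists of matched vertices and meets each matching edge once. The
  game will later decide whether the partner is the parent or a child.\<close>

lemma cover_partner:
  assumes "v \<in> C"
  obtains w where "{v, w} \<in> M" "w \<notin> C" "play_child move v w \<or> play_child move w v"
proof -
  obtain e where e: "e \<in> M" "v \<in> e"
    using cover assms unfolding konig_cover_def by auto
  then obtain x y where xy: "e = {x, y}" "(x, y) \<in> play_rel move"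
    using cover unfolding konig_cover_def matching_def play_graph_def by auto
  define w where "w = (if v = x then y else x)"
  have w: "e = {v, w}" "(v, w) \<in> play_rel move"
    using xy e(2) sym_play_rel[of move] by (auto simp: w_def sym_def)
  then have "v \<noteq> w"
    using irrefl_play_rel[of move] by (auto simp: irrefl_def)
  moreover have "\<exists>!v. v \<in> e \<inter> C"
    using cover e(1) unfolding konig_cover_def by auto
  ultimately have "w \<notin> C" using w assms by auto
  then show thesis using that w e(1) unfolding play_rel_def by auto
qed

lemma cover_partner_unique:
  assumes "{u, w} \<in> M" "{v, w} \<in> M" "u \<in> C" "v \<in> C"
  shows "u = v"
proof -
  have M: "disjoint M" "\<forall>e\<in>M. \<exists>!v. v \<in> e \<inter> C"
    using cover unfolding konig_cover_def matching_def play_graph_def by simp_all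
  have "{u, w} \<inter> {v, w} \<noteq> {}" by simp
  then have "{u, w} = {v, w}"
    using M(1) assms(1,2) unfolding disjoint_def by metis
  then show ?thesis
    using M(2) assms by (metis IntI insertI1)
qed

text \<open>If a play at a winning position were not covered, both copies of a losing continuation
  would be, and they cannot both be matched with it.\<close>

lemma winning_losing_cover:
  "winning move s \<Longrightarrow> \<forall>u i. continue u s i \<in> C"
  "losing move s \<Longrightarrow> \<forall>u i v. play_child move (continue u s i) v \<longrightarrow> v \<in> C"
proof (induction rule: winning_losing.inducts)
  case (winningI s t)
  show ?case
  proof (intro allI, rule ccontr)
    fix u i
    let ?v = "continue u s i"
    assume uncovered: "?v \<notin> C"
    have matched: "continue ?v t j \<in> C \<and> {continue ?v t j, ?v} \<in> M" for j
    proof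
      have "play_child move ?v (continue ?v t j)"
        using winningI(1) unfolding play_child_def by blast
      then show covered: "continue ?v t j \<in> C" using cover_edge uncovered by blast
      obtain w where w: "{continue ?v t j, w} \<in> M" "w \<notin> C"
        "play_child move (continue ?v t j) w \<or> play_child move w (continue ?v t j)"
        using cover_partner covered by blast
      \<comment> \<open>All children of this play at the losing \<open>t\<close> are covered by the
        induction hypothesis, so the uncovered partner can only be the parent.\<close>
      then have "play_child move w (continue ?v t j)" using winningI(3) by blast
      then have "w = ?v" unfolding play_child_def by auto
      then show "{continue ?v t j, ?v} \<in> M" using w by simp
    qed
    have "continue ?v t 0 = continue ?v t 1"
      using matched cover_partner_unique by blast
    then show False by simp
  qed
next
  case (losingI s)
  then show ?case unfolding play_child_def by auto
qed

text \<open>A root has no parent, so a covered root is matched with an uncovered child; at a losing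
  position there is none.\<close>

lemma decided_cover:
  assumes "decided move \<phi> s"
  shows "continue 0 s i \<in> C \<longleftrightarrow> \<phi>"
proof (cases \<phi>)
  case True
  then show ?thesis using assms winning_losing_cover(1) unfolding decided_def by auto
next
  case False
  then have "losing move s" using assms unfolding decided_def by auto
  moreover have "\<not> play_child move w (continue 0 s i)" for w
    unfolding play_child_def by (auto dest: sym)
  ultimately have "continue 0 s i \<notin> C"
    using cover_partner winning_losing_cover(2) by metis
  then show ?thesis using False by simp
qed

end


section \<open>A game deciding the jump hierarchy\<close>

text \<open>The player to move loses at \<open>pos_lost a\<close> and wins
  \<^item> at \<open>pos_mem b n\<close> iff \<open>n\<close> is in the \<open>b\<close>-th set of the hierarchy,
  \<^item> at \<open>pos_nonmin b\<close> iff \<open>b\<close> is not minimal,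
  \<^item> at \<open>pos_eval b e x y\<close> iff program number \<open>e\<close> maps \<open>x\<close> to \<open>y\<close> relative to the join of the sets
    below \<open>b\<close>,
  \<^item> at \<open>pos_nonzero b e x k\<close> iff program number \<open>e\<close> has a nonzero value at \<open>(x, j)\<close> for all
    \<open>j < k\<close>,
  \<^item> at \<open>pos_rec b c d a n y\<close> iff the primitive recursion from programs number \<open>c\<close> and \<open>d\<close> with
    parameter \<open>a\<close> takes the value \<open>y\<close> at \<open>n\<close>,
  \<^item> at \<open>pos_both s t\<close> iff \<open>s\<close> or \<open>t\<close> is lost for the player to move there.

  Thus moving to \<open>pos_both s t\<close> amounts to claiming both \<open>s\<close> and \<open>t\<close>, and minimality is claimed by
  moving to \<open>pos_nonmin b\<close>.\<close>

definition "pos_lost a = prod_encode (0, a)"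
definition "pos_mem b n = prod_encode (1, prod_encode (b, n))"
definition "pos_nonmin b = prod_encode (2, b)"
definition "pos_eval b e x y =
  prod_encode (3, prod_encode (b, prod_encode (e, prod_encode (x, y))))"
definition "pos_nonzero b e x k =
  prod_encode (4, prod_encode (b, prod_encode (e, prod_encode (x, k))))"
definition "pos_rec b c d a n y =
  prod_encode (5, prod_encode (b, prod_encode (c, prod_encode (d,
    prod_encode (a, prod_encode (n, y))))))"
definition "pos_both s t = prod_encode (6, prod_encode (s, t))"

lemmas pos_defs = pos_lost_def pos_mem_def pos_nonmin_def pos_eval_def pos_nonzero_def
  pos_rec_def pos_both_def

text \<open>The player to move backs a claim by naming its witness, and the opponent attacks one
  half of \<open>pos_both\<close>. The position \<open>pos_both s s\<close> merely hands
  \<open>s\<close> back to the claimant, while a move straight to \<open>s\<close> claims that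
  \<open>s\<close> is lost, as for oracle answer 0. The condition \<open>(b, b) \<in> L\<close>
  keeps the sets outside the field empty.\<close>

inductive hmove :: "nat rel \<Rightarrow> nat set \<Rightarrow> nat \<Rightarrow> nat \<Rightarrow> bool" for L A where
  "hmove L A (pos_both s t) s"
| "hmove L A (pos_both s t) t"
| "(a, b) \<in> L \<Longrightarrow> a \<noteq> b \<Longrightarrow> hmove L A (pos_nonmin b) (pos_lost a)"
| "(b, b) \<in> L \<Longrightarrow> n \<in> A \<Longrightarrow> hmove L A (pos_mem b n) (pos_nonmin b)"
| "hmove L A (pos_mem b n) (pos_both (pos_nonmin b) (pos_eval b n n y))"
| "hmove L A (pos_eval b 0 x 0) (pos_lost 0)"
| "hmove L A (pos_eval b 1 x (Suc x)) (pos_lost 0)"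
| "hmove L A (pos_eval b 2 (prod_encode (y, z)) y) (pos_lost 0)"
| "hmove L A (pos_eval b 3 (prod_encode (z, y)) y) (pos_lost 0)"
| "(a, b) \<in> L \<Longrightarrow> a \<noteq> b \<Longrightarrow>
     hmove L A (pos_eval b 4 (prod_encode (a, n)) 1) (pos_both (pos_mem a n) (pos_mem a n))"
| "(a, b) \<in> L \<Longrightarrow> a \<noteq> b \<Longrightarrow> hmove L A (pos_eval b 4 (prod_encode (a, n)) 0) (pos_mem a n)"
| "\<not> ((a, b) \<in> L \<and> a \<noteq> b) \<Longrightarrow> hmove L A (pos_eval b 4 (prod_encode (a, n)) 0) (pos_lost 0)"
| "e = 4 * prod_encode (c, d) + 5 \<Longrightarrow>
     hmove L A (pos_eval b e x (prod_encode (y, z))) (pos_both (pos_eval b c x y) (pos_eval b d x z))"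
| "e = 4 * prod_encode (c, d) + 6 \<Longrightarrow>
     hmove L A (pos_eval b e x y) (pos_both (pos_eval b d x z) (pos_eval b c z y))"
| "e = 4 * prod_encode (c, d) + 7 \<Longrightarrow>
     hmove L A (pos_eval b e (prod_encode (a, n)) y)
       (pos_both (pos_rec b c d a n y) (pos_rec b c d a n y))"
| "e = 4 * c + 8 \<Longrightarrow>
     hmove L A (pos_eval b e x y)
       (pos_both (pos_eval b c (prod_encode (x, y)) 0) (pos_nonzero b c x y))"
| "hmove L A (pos_rec b c d a 0 y) (pos_both (pos_eval b c a y) (pos_eval b c a y))"
| "hmove L A (pos_rec b c d a (Suc n) y)
     (pos_both (pos_rec b c d a n z) (pos_eval b d (prod_encode (a, prod_encode (n, z))) y))"
| "hmove L A (pos_nonzero b e x 0) (pos_lost 0)"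
| "hmove L A (pos_nonzero b e x (Suc k))
     (pos_both (pos_nonzero b e x k) (pos_eval b e (prod_encode (x, k)) (Suc y)))"

text \<open>Readings of the two halves of a name that make sense for every oracle, as
  \<open>effective\<close> requires.\<close>

definition rel_of :: "baire \<Rightarrow> nat rel" where
  "rel_of p = {(a, b). p (2 * prod_encode (a, b)) = 1}"

definition set_of :: "baire \<Rightarrow> nat set" where
  "set_of p = {n. p (2 * n + 1) = 1}"

section \<open>Uniform decidability of the moves\<close>

lemma eq_prod_encode_iff:
  "s = prod_encode (a, b) \<longleftrightarrow> fst (prod_decode s) = a \<and> snd (prod_decode s) = b"
  by (metis fst_conv prod.collapse prod_decode_inverse prod_encode_inverse snd_conv)

lemma eq_Suc_iff: "m = Suc n \<longleftrightarrow> m \<noteq> 0 \<and> m - 1 = n"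
  by auto

lemma ex_eq_Suc_iff: "(\<exists>n. m = Suc n) \<longleftrightarrow> m \<noteq> 0"
  by (cases m) auto

lemma effective_pred_rel_of:
  assumes "effective f" "effective g"
  shows "effective_pred (\<lambda>p x. (f p x, g p x) \<in> rel_of p)"
  unfolding rel_of_def mem_Collect_eq prod.case by (intro effective_intros assms)

lemma effective_pred_set_of:
  assumes "effective f"
  shows "effective_pred (\<lambda>p x. f p x \<in> set_of p)"
  unfolding set_of_def mem_Collect_eq by (intro effective_intros assms)

text \<open>All parameters of a rule can be read off from the two positions, so the existential
  quantifiers over them are replaced by projections.\<close>

context
  notes eq_prod_encode_iff [simp] ex_eq_Suc_iff [simp]
begin

lemmas hmove_projections = hmove.simps[of L A s t for L A s t, unfolded pos_defs, simplified]

lemmas play_child_projections = play_child_def[of move u v for move u v,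
    unfolded continue_def eq_Suc_iff, simplified]

end

lemma effective_pred_hmove:
  assumes "effective f" "effective g"
  shows "effective_pred (\<lambda>p x. hmove (rel_of p) (set_of p) (f p x) (g p x))"
  unfolding hmove_projections imp_conv_disj One_nat_def neq0_conv[symmetric]
  by (intro effective_intros effective_pred_rel_of effective_pred_set_of assms)

lemma effective_pred_play_child:
  assumes "effective f" "effective g"
  shows "effective_pred (\<lambda>p x. play_child (hmove (rel_of p) (set_of p)) (f p x) (g p x))"
  unfolding play_child_projections neq0_conv[symmetric] One_nat_def[symmetric]
  by (intro effective_intros effective_pred_hmove assms)

section \<open>Available moves and the outcome of simple positions\<close>

lemma hmove_iffs:
  "hmove L A (pos_lost a) r \<longleftrightarrow> False"
  "hmove L A (pos_both s t) r \<longleftrightarrow> r = s \<or> r = t"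
  "hmove L A (pos_nonmin b) r \<longleftrightarrow> (\<exists>a. ((a, b) \<in> L \<and> a \<noteq> b) \<and> r = pos_lost a)"
  "hmove L A (pos_mem b n) r \<longleftrightarrow> (b, b) \<in> L \<and> n \<in> A \<and> r = pos_nonmin b \<or>
     (\<exists>y. r = pos_both (pos_nonmin b) (pos_eval b n n y))"
  "hmove L A (pos_rec b c d a 0 y) r \<longleftrightarrow> r = pos_both (pos_eval b c a y) (pos_eval b c a y)"
  "hmove L A (pos_rec b c d a (Suc n) y) r \<longleftrightarrow>
     (\<exists>z. r = pos_both (pos_rec b c d a n z)
        (pos_eval b d (prod_encode (a, prod_encode (n, z))) y))"
  "hmove L A (pos_nonzero b e x 0) r \<longleftrightarrow> r = pos_lost 0"
  "hmove L A (pos_nonzero b e x (Suc k)) r \<longleftrightarrow>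
     (\<exists>y. r = pos_both (pos_nonzero b e x k) (pos_eval b e (prod_encode (x, k)) (Suc y)))"
  by (subst hmove.simps, simp add: pos_defs; blast)+

text \<open>The offsets of the four compound constructors are distinct modulo 4.\<close>

lemma code_distinct:
  fixes m n :: nat
  assumes "i \<in> {5, 6, 7, 8}" "j \<in> {5, 6, 7, 8}"
  shows "4 * m + i = 4 * n + j \<longleftrightarrow> i = j \<and> m = n"
  using assms by (auto; presburger)

lemma hmove_eval_iffs:
  "hmove L A (pos_eval b (prog_number Zero) x y) r \<longleftrightarrow> y = 0 \<and> r = pos_lost 0"
  "hmove L A (pos_eval b (prog_number Succ) x y) r \<longleftrightarrow> y = Suc x \<and> r = pos_lost 0"
  "hmove L A (pos_eval b (prog_number Proj1) x y) r \<longleftrightarrow>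
     y = fst (prod_decode x) \<and> r = pos_lost 0"
  "hmove L A (pos_eval b (prog_number Proj2) x y) r \<longleftrightarrow>
     y = snd (prod_decode x) \<and> r = pos_lost 0"
  "hmove L A (pos_eval b (prog_number Query) (prod_encode (a, n)) y) r \<longleftrightarrow>
     (if (a, b) \<in> L \<and> a \<noteq> b
      then y = 1 \<and> r = pos_both (pos_mem a n) (pos_mem a n) \<or> y = 0 \<and> r = pos_mem a n
      else y = 0 \<and> r = pos_lost 0)"
  "hmove L A (pos_eval b (prog_number (Tuple c d)) x y) r \<longleftrightarrow>
     r = pos_both (pos_eval b (prog_number c) x (fst (prod_decode y)))
       (pos_eval b (prog_number d) x (snd (prod_decode y)))"
  "hmove L A (pos_eval b (prog_number (Comp c d)) x y) r \<longleftrightarrow>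
     (\<exists>z. r = pos_both (pos_eval b (prog_number d) x z) (pos_eval b (prog_number c) z y))"
  "hmove L A (pos_eval b (prog_number (PrimRec c d)) (prod_encode (a, n)) y) r \<longleftrightarrow>
     r = pos_both (pos_rec b (prog_number c) (prog_number d) a n y)
       (pos_rec b (prog_number c) (prog_number d) a n y)"
  "hmove L A (pos_eval b (prog_number (Mu c)) x y) r \<longleftrightarrow>
     r = pos_both (pos_eval b (prog_number c) (prod_encode (x, y)) 0)
       (pos_nonzero b (prog_number c) x y)"
  by (subst hmove.simps,
      simp add: pos_defs code_distinct eq_prod_encode_iff[of x] eq_prod_encode_iff[of y]; fastforce)+

declare prog_number.simps [simp del]

lemma decided_lost: "decided (hmove L A) False (pos_lost a)"
  by (rule decidedI) (auto simp: hmove_iffs)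

lemma decided_both:
  assumes "decided (hmove L A) \<phi> s" "decided (hmove L A) \<psi> t"
  shows "decided (hmove L A) (\<not> (\<phi> \<and> \<psi>)) (pos_both s t)"
  using assms unfolding decided_def by (auto simp: hmove_iffs intro: winning_losing.intros)

lemma decided_both_same:
  "decided (hmove L A) \<phi> s \<Longrightarrow> decided (hmove L A) (\<not> \<phi>) (pos_both s s)"
  using decided_both[of L A \<phi> s \<phi> s] by simp

text \<open>The mover picks \<open>z\<close>; the negation appears since the opponent is to move at
  \<open>h z\<close>.\<close>

lemma decided_choice:
  assumes "\<And>r. move s r \<longleftrightarrow> (\<exists>z. r = h z)" "\<And>z. decided move (\<not> \<phi> z) (h z)"
  shows "decided move (\<exists>z. \<phi> z) s"
  using assms unfolding decided_def by (metis winning_losing.intros)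

lemma decided_single:
  assumes "\<And>r. move s r \<longleftrightarrow> r = t" "decided move (\<not> \<phi>) t"
  shows "decided move \<phi> s"
  using assms unfolding decided_def by (metis winning_losing.intros)

lemma decided_lost_if:
  assumes "\<And>r. hmove L A s r \<longleftrightarrow> \<phi> \<and> r = pos_lost 0"
  shows "decided (hmove L A) \<phi> s"
  using assms decided_lost[of L A 0] unfolding decided_def by (auto intro: winning_losing.intros)

lemma decided_nonmin: "decided (hmove L A) (underS L b \<noteq> {}) (pos_nonmin b)"
  by (rule decidedI[where \<phi> = "\<lambda>_. False"])
    (auto simp: hmove_iffs underS_def intro: decided_lost)

text \<open>Minimality of the claimed value \<open>y\<close> becomes the finitely many claims that
  \<open>pos_nonzero\<close> debates.\<close>

lemma run_Mu_eq_Some_iff: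
  "run p (Mu c) x = Some y \<longleftrightarrow>
     run p c (prod_encode (x, y)) = Some 0 \<and>
     (\<forall>j<y. \<exists>r. run p c (prod_encode (x, j)) = Some (Suc r))"
  (is "?L \<longleftrightarrow> ?R")
proof
  let ?P = "\<lambda>k. run p c (prod_encode (x, k)) = Some 0"
  assume ?L
  then obtain k where k: "?P k" "\<forall>j<k. run p c (prod_encode (x, j)) \<noteq> None"
    and y: "y = (LEAST k. ?P k)"
    by (auto split: if_splits)
  have "?P y" using k(1) unfolding y by (rule LeastI)
  moreover have "y \<le> k" using k(1) unfolding y by (rule Least_le)
  moreover have "\<not> ?P j" if "j < y" for j using not_less_Least that unfolding y by blast
  ultimately show ?R using k(2)
    by (metis less_le_trans not0_implies_Suc option.exhaust)
next
  assume R: ?R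
  then have "(LEAST k. run p c (prod_encode (x, k)) = Some 0) = y"
    by (intro Least_equality) (auto simp: not_less[symmetric])
  moreover have "\<exists>k. run p c (prod_encode (x, k)) = Some 0 \<and>
      (\<forall>j<k. run p c (prod_encode (x, j)) \<noteq> None)"
    using R by (intro exI[of _ y]) force
  ultimately show ?L by simp
qed

section \<open>Debating a computation relative to the sets below a fixed element\<close>

context
  fixes L :: "nat rel" and A :: "nat set" and X :: "nat \<Rightarrow> nat set" and b :: nat
  assumes decided_below: "\<And>a n. a \<in> underS L b \<Longrightarrow> decided (hmove L A) (n \<in> X a) (pos_mem a n)"
begin

abbreviation "below \<equiv> char_fun (join_family (underS L b) X)"

abbreviation "computes c \<equiv> \<forall>x y.
  decided (hmove L A) (run below c x = Some y) (pos_eval b (prog_number c) x y)"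

text \<open>Here the debate descends in the ordering: a query inside the join leads to a membership
  position below \<open>b\<close>, decided by assumption.\<close>

lemma decided_query: "computes Query"
proof (intro allI)
  fix x y
  obtain a n where x: "x = prod_encode (a, n)" by (metis prod_decode_inverse surj_pair)
  let ?e = "pos_eval b (prog_number Query) x y"
  have query: "below x = of_bool (a \<in> underS L b \<and> n \<in> X a)"
    by (auto simp: char_fun_def join_family_def x)
  show "decided (hmove L A) (run below Query x = Some y) ?e"
  proof (cases "a \<in> underS L b")
    case True
    then have moves: "hmove L A ?e r \<longleftrightarrow>
      y = 1 \<and> r = pos_both (pos_mem a n) (pos_mem a n) \<or> y = 0 \<and> r = pos_mem a n" for r
      by (auto simp: x hmove_eval_iffs underS_def)
    have a: "decided (hmove L A) (n \<in> X a) (pos_mem a n)"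
      using decided_below True by blast
    \<comment> \<open>A characteristic function has only the values 0 and 1; a claim of any other
      value has no move and is lost.\<close>
    consider "y = 0" | "y = 1" | "y > 1" by linarith
    then show ?thesis
    proof cases
      case 1
      then have move: "hmove L A ?e r \<longleftrightarrow> r = pos_mem a n" for r
        using moves by simp
      have answer: "(\<not> run below Query x = Some y) = (n \<in> X a)"
        using 1 True by (simp add: query)
      show ?thesis by (rule decided_single, rule move) (simp only: answer a)
    next
      case 2
      then have move: "hmove L A ?e r \<longleftrightarrow> r = pos_both (pos_mem a n) (pos_mem a n)" for r
        using moves by simp
      have answer: "(\<not> run below Query x = Some y) = (\<not> n \<in> X a)"
        using 2 True by (simp add: query)
      show ?thesis by (rule decided_single, rule move) (simp only: answer decided_both_same[OF a])
    next
      case 3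
      then show ?thesis by (intro decided_lost_if) (auto simp: query moves)
    qed
  next
    case False
    then have "\<not> ((a, b) \<in> L \<and> a \<noteq> b)" by (auto simp: underS_def)
    then have "hmove L A ?e r \<longleftrightarrow> y = 0 \<and> r = pos_lost 0" for r
      unfolding x hmove_eval_iffs by (simp only: if_False)
    moreover have "run below Query x = Some y \<longleftrightarrow> y = 0"
      using False by (auto simp: query)
    ultimately show ?thesis by (intro decided_lost_if) (simp only:)
  qed
qed

lemma decided_tuple:
  assumes "computes c" "computes d"
  shows "computes (Tuple c d)"
proof (intro allI, rule decided_single)
  fix x y
  let ?\<phi> = "run below c x = Some (fst (prod_decode y)) \<and>
      run below d x = Some (snd (prod_decode y))"
  have "run below (Tuple c d) x = Some y \<longleftrightarrow> ?\<phi>"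
    by (auto simp: bind_eq_Some_conv eq_prod_encode_iff[of y])
  then show "decided (hmove L A) (run below (Tuple c d) x \<noteq> Some y)
      (pos_both (pos_eval b (prog_number c) x (fst (prod_decode y)))
        (pos_eval b (prog_number d) x (snd (prod_decode y))))"
    using decided_both assms by presburger
qed (rule hmove_eval_iffs)

lemma decided_comp:
  assumes "computes c" "computes d"
  shows "computes (Comp c d)"
proof (intro allI)
  fix x y
  have "run below (Comp c d) x = Some y \<longleftrightarrow>
      (\<exists>z. run below d x = Some z \<and> run below c z = Some y)"
    by (simp add: bind_eq_Some_conv)
  moreover have "decided (hmove L A) \<dots> (pos_eval b (prog_number (Comp c d)) x y)"
    by (rule decided_choice, rule hmove_eval_iffs, rule decided_both) (simp_all only: assms)
  ultimately show "decided (hmove L A) (run below (Comp c d) x = Some y)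
    (pos_eval b (prog_number (Comp c d)) x y)" by (simp only:)
qed

text \<open>Induction on \<open>n\<close>: the player names the previous value \<open>z\<close> and
  claims both that it is right and that the step program leads from it to \<open>y\<close>.\<close>

lemma decided_rec:
  assumes "computes c" "computes d"
  shows "decided (hmove L A)
    (rec_nat (run below c a)
       (\<lambda>m r. Option.bind r (\<lambda>y. run below d (prod_encode (a, prod_encode (m, y))))) n = Some y)
    (pos_rec b (prog_number c) (prog_number d) a n y)"
proof (induction n arbitrary: y)
  case 0
  show ?case
    unfolding old.nat.simps(6)
    by (rule decided_single, rule hmove_iffs, rule decided_both_same) (simp only: assms)
next
  case (Suc n)
  show ?case
    unfolding old.nat.simps(7) bind_eq_Some_conv
    by (rule decided_choice, rule hmove_iffs, rule decided_both, rule Suc.IH)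
      (simp only: assms)
qed

lemma decided_prim_rec:
  assumes "computes c" "computes d"
  shows "computes (PrimRec c d)"
proof (intro allI)
  fix x y
  obtain a n where x: "x = prod_encode (a, n)" by (metis prod_decode_inverse surj_pair)
  have "run below (PrimRec c d) x = rec_nat (run below c a)
      (\<lambda>m r. Option.bind r (\<lambda>y. run below d (prod_encode (a, prod_encode (m, y))))) n"
    by (simp add: x)
  then have *: "decided (hmove L A) (run below (PrimRec c d) x = Some y)
      (pos_rec b (prog_number c) (prog_number d) a n y)"
    using decided_rec[OF assms] by presburger
  show "decided (hmove L A) (run below (PrimRec c d) x = Some y)
      (pos_eval b (prog_number (PrimRec c d)) x y)"
    unfolding x
    by (rule decided_single, rule hmove_eval_iffs, rule decided_both_same, rule *[unfolded x])
qed

lemma decided_nonzero: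
  assumes "computes c"
  shows "decided (hmove L A) (\<forall>j<k. \<exists>r. run below c (prod_encode (x, j)) = Some (Suc r))
    (pos_nonzero b (prog_number c) x k)"
proof (induction k)
  case 0
  show ?case by (rule decided_lost_if) (simp add: hmove_iffs)
next
  case (Suc k)
  have "decided (hmove L A)
    (\<exists>r. (\<forall>j<k. \<exists>r. run below c (prod_encode (x, j)) = Some (Suc r)) \<and>
      run below c (prod_encode (x, k)) = Some (Suc r))
    (pos_nonzero b (prog_number c) x (Suc k))"
    by (rule decided_choice, rule hmove_iffs, rule decided_both, rule Suc.IH)
      (simp only: assms)
  then show ?case by (simp add: All_less_Suc conj_commute)
qed

lemma decided_mu:
  assumes "computes c"
  shows "computes (Mu c)"
  unfolding run_Mu_eq_Some_iff
  by (intro allI, rule decided_single, rule hmove_eval_iffs, rule decided_both)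
    (simp_all only: assms decided_nonzero[OF assms])

lemma decided_eval: "computes c"
proof (induction c)
  case Zero
  show ?case by (intro allI decided_lost_if) (auto simp: hmove_eval_iffs)
next
  case Succ
  show ?case by (intro allI decided_lost_if) (auto simp: hmove_eval_iffs)
next
  case Proj1
  show ?case by (intro allI decided_lost_if) (auto simp: hmove_eval_iffs)
next
  case Proj2
  show ?case by (intro allI decided_lost_if) (auto simp: hmove_eval_iffs)
qed (intro decided_query decided_tuple decided_comp decided_prim_rec decided_mu; assumption?)+

text \<open>Two kinds of move compete, and \<open>pos_nonmin b\<close> selects one: for minimal
  \<open>b\<close> the claim of a computation fails, otherwise the claim of minimality does.\<close>

lemma decided_mem:
  "decided (hmove L A)
     (if underS L b = {} then (b, b) \<in> L \<and> n \<in> A else n \<in> jump (join_family (underS L b) X))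
     (pos_mem b n)"
proof -
  \<comment> \<open>By surjectivity every \<open>n\<close> is the number of an actual program, so
    \<open>decided_eval\<close> applies.\<close>
  obtain c where c: "n = prog_number c" using surj_prog_number by (metis surjD)
  have eval: "decided (hmove L A) (\<not> (underS L b \<noteq> {} \<and> run below c n = Some y))
      (pos_both (pos_nonmin b) (pos_eval b n n y))" for y
    using decided_both[OF decided_nonmin] decided_eval c by blast
  have jump: "n \<in> jump (join_family (underS L b) X) \<longleftrightarrow> (\<exists>y. run below c n = Some y)"
    unfolding jump_def using c inj_prog_number by (auto dest: injD)
  show ?thesis
  proof (cases "underS L b = {}")
    case True
    then have "winning (hmove L A) (pos_both (pos_nonmin b) (pos_eval b n n y))" for y
      using eval[of y] unfolding decided_def by simp
    moreover have "losing (hmove L A) (pos_nonmin b)"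
      using decided_nonmin[of L A b] True unfolding decided_def by simp
    ultimately have "if (b, b) \<in> L \<and> n \<in> A then winning (hmove L A) (pos_mem b n)
        else losing (hmove L A) (pos_mem b n)"
      using winningI[of "hmove L A" "pos_mem b n" "pos_nonmin b"]
        losingI[of "hmove L A" "pos_mem b n"] by (auto simp: hmove_iffs)
    then show ?thesis using True unfolding decided_def by simp
  next
    case False
    then have "winning (hmove L A) (pos_nonmin b)"
      using decided_nonmin[of L A b] unfolding decided_def by simp
    then have "run below c n \<noteq> Some y \<Longrightarrow>
        winning (hmove L A) (pos_both (pos_nonmin b) (pos_eval b n n y))"
      and "run below c n = Some y \<Longrightarrow>
        losing (hmove L A) (pos_both (pos_nonmin b) (pos_eval b n n y))" for y
      using eval[of y] False unfolding decided_def by simp_all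
    moreover note \<open>winning (hmove L A) (pos_nonmin b)\<close>
    ultimately have "decided (hmove L A) (\<exists>y. run below c n = Some y) (pos_mem b n)"
      unfolding decided_def
      by (cases "\<exists>y. run below c n = Some y")
        (fastforce simp: hmove_iffs intro: winning_losing.intros)+
    then show ?thesis using False jump by simp
  qed
qed

end

text \<open>No hierarchy is presupposed: the sets are read off from \<open>C\<close>. Once they
  decide the positions below \<open>b\<close>, the recursion formula decides those at
  \<open>b\<close>, and \<open>C\<close> agrees with whatever decides a position; this closes a
  well-founded induction.\<close>

lemma cover_jump_hierarchy:
  assumes "Well_order L"
    and cover: "konig_cover (play_graph (hmove L A)) (C, M)"
  shows "jump_hierarchy L A (\<lambda>b. {n. continue 0 (pos_mem b n) 0 \<in> C})"
proof -
  define X where "X = (\<lambda>b. {n. continue 0 (pos_mem b n) 0 \<in> C})"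
  have wf: "wf (L - Id)" and refl: "refl_on (Field L) L"
    using assms(1) by (simp_all add: order_on_defs)
  have X: "decided (hmove L A) \<phi> (pos_mem b n) \<Longrightarrow> n \<in> X b \<longleftrightarrow> \<phi>" for \<phi> b n
    unfolding X_def using decided_cover[OF cover] by simp
  have decided: "decided (hmove L A) (n \<in> X b) (pos_mem b n)" for b n
    using wf
  proof (induction b arbitrary: n rule: wf_induct_rule)
    case (less b)
    then have "decided (hmove L A) (n \<in> X a) (pos_mem a n)" if "a \<in> underS L b" for a n
      using that by (auto simp: underS_def)
    then have "decided (hmove L A)
        (if underS L b = {} then (b, b) \<in> L \<and> n \<in> A else n \<in> jump (join_family (underS L b) X))
        (pos_mem b n)" (is "decided _ ?\<phi> _")
      by (rule decided_mem)
    moreover from this have "(n \<in> X b) = ?\<phi>" by (rule X)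
    ultimately show ?case by (simp only:)
  qed
  note mem = X[OF decided_mem[OF decided]]
  have "X b = (if underS L b = {} then A else jump (join_family (underS L b) X))"
    if "b \<in> Field L" for b
  proof -
    have "(b, b) \<in> L" using that refl by (auto simp: refl_on_def)
    then have "n \<in> X b \<longleftrightarrow> n \<in> (if underS L b = {} then A else jump (join_family (underS L b) X))"
      for n using mem[of n b]
      by (cases "underS L b = {}") (simp_all only: if_True if_False simp_thms)
    then show ?thesis by (rule set_eqI)
  qed
  moreover have "X b = {}" if "b \<notin> Field L" for b
  proof -
    have "underS L b = {}" "(b, b) \<notin> L" using that by (auto simp: underS_def Field_def)
    then have "n \<notin> X b" for n using mem[of n b] by (simp only: if_True simp_thms)
    then show ?thesis by blast
  qed
  ultimately show ?thesis unfolding jump_hierarchy_def X_def[symmetric] by blast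
qed

section \<open>Names and the reduction\<close>

lemma set_rep_of_bool: "set_rep (\<lambda>n. of_bool (P n)) = Some {n. P n}"
  by (auto simp: set_rep_def)

lemma set_rep_SomeD: "set_rep p = Some S \<Longrightarrow> S = {n. p n = 1}"
  by (auto simp: set_rep_def split: if_splits)

theorem theorem9p19: "ATR \<le>\<^sub>W KDT"
proof -
  let ?move = "\<lambda>p. hmove (rel_of p) (set_of p)"
  let ?adjacent = "\<lambda>p k. (fst (prod_decode k), snd (prod_decode k)) \<in> play_rel (?move p)"
  \<comment> \<open>Even places all carry 1 and name the vertex set; odd places carry the adjacency
    relation.\<close>
  let ?\<Phi> = "\<lambda>p. Some (\<lambda>n. of_bool (\<not> (odd n \<and> \<not> ?adjacent p (n div 2))) :: nat)"
  let ?vertex = "\<lambda>k. continue 0 (pos_mem (fst (prod_decode k)) (snd (prod_decode k))) 0"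
  \<comment> \<open>Odd places of the join hold the name of the cover, whose even places hold
    \<open>C\<close>. The root label 0 is arbitrary.\<close>
  let ?\<Psi> = "\<lambda>r. Some (\<lambda>k. of_bool (r (2 * (2 * ?vertex k) + 1) = 1) :: nat)"
  have "computable ?\<Phi>"
    unfolding play_rel_def mem_Collect_eq prod.case
    by (intro computable_effective_pred effective_pred_not effective_pred_conj effective_pred_disj
        effective_pred_odd effective_pred_play_child effective_fst effective_snd effective_div2
        effective_id)
  moreover have "computable ?\<Psi>"
    unfolding continue_def pos_mem_def
    by (intro computable_effective_pred effective_intros)
  moreover have "\<exists>p' x'. ?\<Phi> p = Some p' \<and> instance_rep KDT p' = Some x' \<and> x' \<in> instances KDT \<and>
      (\<forall>q y'. solution_rep KDT q = Some y' \<and> y' \<in> solutions KDT x' \<longrightarrow>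
        (\<exists>q' y. ?\<Psi> (p \<oplus>\<^sub>B q) = Some q' \<and> solution_rep ATR q' = Some y \<and> y \<in> solutions ATR x))"
    if p: "instance_rep ATR p = Some x" "x \<in> instances ATR" for p x
  proof -
    obtain L A where x: "x = (L, A)" by fastforce
    have LA: "Well_order L" "L = rel_of p" "A = set_of p"
      using p unfolding x
      by (auto simp: ATR_def prod_rep_def rel_rep_def bind_eq_Some_conv rel_of_def set_of_def
          dest!: set_rep_SomeD)
    let ?p' = "\<lambda>n. of_bool (\<not> (odd n \<and> \<not> ?adjacent p (n div 2))) :: nat"
    have "set_rep (\<lambda>n. ?p' (2 * n)) = Some UNIV"
      by (simp add: set_rep_def)
    moreover have "edges_rep (\<lambda>n. ?p' (2 * n + 1)) =
        Some {{u, v} | u v. (u, v) \<in> play_rel (?move p)}"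
      using sym_play_rel[of "?move p"] irrefl_play_rel[of "?move p"]
      by (simp add: edges_rep_def rel_rep_def set_rep_of_bool)
    ultimately have "instance_rep KDT ?p' = Some (play_graph (hmove L A))"
      by (simp add: KDT_def prod_rep_def play_graph_def LA)
    moreover have "\<exists>q' y. ?\<Psi> (p \<oplus>\<^sub>B q) = Some q' \<and> solution_rep ATR q' = Some y \<and>
        y \<in> solutions ATR x"
      if q: "solution_rep KDT q = Some y'" "y' \<in> solutions KDT (play_graph (hmove L A))" for q y'
    proof -
      obtain C M where y': "y' = (C, M)" by fastforce
      then have cover: "konig_cover (play_graph (hmove L A)) (C, M)"
        using q by (simp add: KDT_def)
      have C: "v \<in> C \<longleftrightarrow> q (2 * v) = 1" for v
        using q(1) unfolding y'
        by (auto simp: KDT_def prod_rep_def bind_eq_Some_conv dest!: set_rep_SomeD)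
      have "solution_rep ATR (the (?\<Psi> (p \<oplus>\<^sub>B q))) =
          Some (\<lambda>b. {n. continue 0 (pos_mem b n) 0 \<in> C})"
        by (simp add: ATR_def seq_rep_def set_rep_of_bool join_def C)
      then show ?thesis
        using cover_jump_hierarchy[OF LA(1) cover] by (simp add: ATR_def x)
    qed
    moreover have "play_graph (hmove L A) \<in> instances KDT"
      by (simp add: KDT_def bipartite_play_graph)
    ultimately show ?thesis
      by (intro exI[of _ ?p'] exI[of _ "play_graph (hmove L A)"]) blast
  qed
  ultimately show ?thesis unfolding weihrauch_le_def by blast
qed

end
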